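(* Let $H \in C^1(\mathbb{R}^{2n})$ and consider the canonical Hamiltonian system $\dot{\mathbf y}(t) = \mathbf J_{2n}\nabla_{\mathbf y} H(\mathbf y(t)) \in \mathbb{R}^{2n}$. Let $\boldsymbol\Gamma_{\mathrm{QMCL}}:\mathbb{R}^{2r}\to\mathbb{R}^{2n}$ be a quadratic manifold cotangent lift (QMCL) approximation mapping. Then the reduced-order model for $\widetilde{\mathbf y}(t)\in\mathbb{R}^{2r}$ obtained via the symplectic manifold Galerkin (SMG) projection of this system with $\boldsymbol\Gamma_{\mathrm{QMCL}}$, i.e. the system of ordinary differential equations determined by $$\mathsf D\boldsymbol\Gamma_{\mathrm{QMCL}}|_{\widetilde{\mathbf y}(t)}^{+}\left(\frac{\mathrm d}{\mathrm dt}\boldsymbol\Gamma_{\mathrm{QMCL}}(\widetilde{\mathbf y}(t)) - \mathbf J_{2n}\nabla_{\mathbf y}H\big(\boldsymbol\Gamma_{\mathrm{QMCL}}(\widetilde{\mathbf y}(t))\big)\right) = \mathbf 0\in\mathbb{R}^{2r}\quad\text{for all } t,$$ is again a canonical Hamiltonian system; that is, there is a function $\widetilde H\in C^1(\mathbb{R}^{2r})$ such that the reduced-order model is $\dot{\widetilde{\mathbf y}}(t)=\mathbf J_{2r}\nabla_{\widetilde{\mathbf y}}\widetilde H(\widetilde{\mathbf y}(t))$.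
   Context: Let $r\le n$ be positive integers. $\mathbf I_m$ is the $m\times m$ identity and $\mathbf J_{2m}=\begin{pmatrix}\mathbf 0&\mathbf I_m\\-\mathbf I_m&\mathbf 0\end{pmatrix}$. A canonical Hamiltonian system of dimension $2m$ is an ODE $\dot{\mathbf x}=\mathbf J_{2m}\nabla H(\mathbf x)$ with $H\in C^1(\mathbb{R}^{2m})$. $\mathsf D\mathbf f|_{\mathbf x}$ denotes the Jacobian of $\mathbf f$ at $\mathbf x$. For $\mathbf x=(x_1,\dots,x_r)^\top\in\mathbb{R}^r$, $\mathbf x\otimes\mathbf x$ denotes the Kronecker product without redundant terms, $\mathbf x\otimes\mathbf x=(x_1^2,x_1x_2,\dots,x_1x_r,x_2^2,x_2x_3,\dots,x_2x_r,\dots,x_r^2)^\top\in\mathbb{R}^{r(r+1)/2}$, and $\mathbf B(\mathbf x):=\mathsf D(\cdot\otimes\cdot)|_{\mathbf x}\in\mathbb{R}^{r(r+1)/2\times r}$ is the derivative of $\mathbf x\mapsto\mathbf x\otimes\mathbf x$. QMCL mapping: given $\mathbf q_{\mathrm{ref}},\mathbf p_{\mathrm{ref}}\in\mathbb{R}^n$, $\mathbf V_q\in\mathbb{R}^{n\times r}$ and $\overline{\mathbf V}_q\in\mathbb{R}^{n\times r(r+1)/2}$ with $\mathbf V_q^\top\mathbf V_q=\mathbf I_r$ and $\mathbf V_q^\top\overline{\mathbf V}_q=\mathbf 0$, for $\widetilde{\mathbf y}=(\widetilde{\mathbf q}^\top,\widetilde{\mathbf p}^\top)^\top\in\mathbb{R}^{2r}$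 set $$\boldsymbol\Gamma_{\mathrm{QMCL}}(\widetilde{\mathbf q},\widetilde{\mathbf p})=\begin{pmatrix}\mathbf q_{\mathrm{ref}}+\mathbf V_q\widetilde{\mathbf q}+\overline{\mathbf V}_q(\widetilde{\mathbf q}\otimes\widetilde{\mathbf q})\\ \mathbf p_{\mathrm{ref}}+\big(\mathbf V_q+\overline{\mathbf V}_q\mathbf B(\widetilde{\mathbf q})\big)\widetilde{\mathbf v}(\widetilde{\mathbf q},\widetilde{\mathbf p})\end{pmatrix},\qquad \widetilde{\mathbf v}(\widetilde{\mathbf q},\widetilde{\mathbf p})=\big(\mathbf I_r+\mathbf B(\widetilde{\mathbf q})^\top\overline{\mathbf V}_q^\top\overline{\mathbf V}_q\mathbf B(\widetilde{\mathbf q})\big)^{-1}\widetilde{\mathbf p}.$$ For $\mathbf V\in\mathbb{R}^{2n\times 2r}$, the symplectic inverse is $\mathbf V^+:=\mathbf J_{2r}^\top\mathbf V^\top\mathbf J_{2n}$; $\mathsf D\boldsymbol\Gamma_{\mathrm{QMCL}}|_{\widetilde{\mathbf y}}^{+}$ is the symplectic inverse of the Jacobian $\mathsf D\boldsymbol\Gamma_{\mathrm{QMCL}}|_{\widetilde{\mathbf y}}$. *)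

theory Defs
  imports "HOL-Analysis.Analysis" "HOL-Library.Uprod"
begin

text \<open>
  The phase space of dimension \<open>2m\<close> is \<open>real ^ ('m + 'm)\<close> with \<open>m = CARD('m)\<close>: the
  indices \<open>Inl i\<close> are the positions q and the indices \<open>Inr i\<close> the momenta p.
\<close>

definition phase :: "real ^ 'm::finite \<Rightarrow> real ^ 'm \<Rightarrow> real ^ ('m + 'm)" where
  "phase q p = (\<chi> k. case k of Inl i \<Rightarrow> q $ i | Inr i \<Rightarrow> p $ i)"

definition pos_part :: "real ^ ('m::finite + 'm) \<Rightarrow> real ^ 'm" where
  "pos_part y = (\<chi> i. y $ Inl i)"

definition mom_part :: "real ^ ('m::finite + 'm) \<Rightarrow> real ^ 'm" where
  "mom_part y = (\<chi> i. y $ Inr i)"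

definition symp_J :: "real ^ ('m::finite + 'm) ^ ('m + 'm)" where
  "symp_J = (\<chi> k l. case (k, l) of
       (Inl i, Inr j) \<Rightarrow> mat 1 $ i $ j
     | (Inr i, Inl j) \<Rightarrow> - (mat 1 $ i $ j)
     | _ \<Rightarrow> 0)"

definition symplectic_inverse ::
    "real ^ ('r::finite + 'r) ^ ('n::finite + 'n) \<Rightarrow> real ^ ('n + 'n) ^ ('r + 'r)" where
  "symplectic_inverse V = transpose symp_J ** transpose V ** symp_J"

definition grad :: "('a::real_inner \<Rightarrow> real) \<Rightarrow> 'a \<Rightarrow> 'a" where
  "grad f x = (THE D. GDERIV f x :> D)"

definition C1 :: "('a::real_inner \<Rightarrow> real) \<Rightarrow> bool" where
  "C1 f \<longleftrightarrow> (\<exists>g. (\<forall>x. GDERIV f x :> g x) \<and> continuous_on UNIV g)"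

instance uprod :: (finite) finite
  by standard simp

text \<open>
  The Kronecker product without redundant terms has one entry for each unordered pair of
  indices, so its index type is \<open>'r uprod\<close>, which has \<open>r (r + 1) / 2\<close> elements
  (\<open>card_UNIV_uprod\<close>).
\<close>

lift_definition kron_entry :: "real ^ 'r::finite \<Rightarrow> 'r uprod \<Rightarrow> real" is
  "\<lambda>x (i, j). x $ i * x $ j"
  by auto

definition kron :: "real ^ 'r::finite \<Rightarrow> real ^ 'r uprod" where
  "kron x = (\<chi> u. kron_entry x u)"

lemma kron_nth_Upair [simp]:
  fixes x :: "real ^ 'r::finite"
  shows "kron x $ Upair i j = x $ i * x $ j"
  unfolding kron_def by (simp, transfer, simp)

definition kron_deriv :: "real ^ 'r::finite \<Rightarrow> real ^ 'r ^ 'r uprod" where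
  "kron_deriv x = jacobian kron (at x)"

definition qmcl_velocity ::
    "real ^ ('r::finite) uprod ^ 'n::finite \<Rightarrow> real ^ 'r \<Rightarrow> real ^ 'r \<Rightarrow> real ^ 'r" where
  "qmcl_velocity Vbar q p =
     matrix_inv (mat 1 + transpose (kron_deriv q) ** transpose Vbar ** Vbar ** kron_deriv q) *v p"

definition qmcl ::
    "real ^ 'n::finite \<Rightarrow> real ^ 'n \<Rightarrow> real ^ 'r::finite ^ 'n \<Rightarrow> real ^ 'r uprod ^ 'n
      \<Rightarrow> real ^ ('r + 'r) \<Rightarrow> real ^ ('n + 'n)" where
  "qmcl q_ref p_ref V Vbar y =
     phase (q_ref + V *v pos_part y + Vbar *v kron (pos_part y))
           (p_ref + (V + Vbar ** kron_deriv (pos_part y))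
              *v qmcl_velocity Vbar (pos_part y) (mom_part y))"

definition hamiltonian_solution ::
    "(real ^ ('m::finite + 'm) \<Rightarrow> real) \<Rightarrow> real set \<Rightarrow> (real \<Rightarrow> real ^ ('m + 'm)) \<Rightarrow> bool" where
  "hamiltonian_solution H T x \<longleftrightarrow>
     (\<forall>t\<in>T. (x has_vector_derivative symp_J *v grad H (x t)) (at t within T))"

definition smg_solution ::
    "(real ^ ('n::finite + 'n) \<Rightarrow> real) \<Rightarrow> (real ^ ('r::finite + 'r) \<Rightarrow> real ^ ('n + 'n))
      \<Rightarrow> real set \<Rightarrow> (real \<Rightarrow> real ^ ('r + 'r)) \<Rightarrow> bool" where
  "smg_solution H \<Gamma> T y \<longleftrightarrow>
     (\<forall>t\<in>T. y differentiable (at t within T) \<and>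
        symplectic_inverse (jacobian \<Gamma> (at (y t)))
          *v (vector_derivative (\<lambda>s. \<Gamma> (y s)) (at t within T)
                - symp_J *v grad H (\<Gamma> (y t))) = 0)"

end

theory Submission
  imports Defs
begin

text \<open>
  The reduced Hamiltonian is \<open>H_red = H \<circ> \<Gamma>\<close>, where \<open>\<Gamma>\<close> is the QMCL mapping. Two facts about
  \<open>\<Gamma>\<close> are needed: it is \<open>C1\<close> (\<open>C1_qmcl\<close>), and its Jacobian \<open>D\<close> is a symplectic matrix at every
  point (\<open>qmcl_jacobian_symplectic\<close>).

  Given these, \<open>D\<^sup>+ D = 1\<close>, and \<open>D\<^sup>+ J = J D\<^sup>T\<close> because \<open>J\<^sup>2 = -1\<close> and \<open>J\<^sup>T = -J\<close>. By the
  chain rule the velocity of \<open>\<Gamma> (y t)\<close> is \<open>D y'\<close>, and the gradient of \<open>H_red\<close> is \<open>D\<^sup>T\<close> applied to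
  the gradient of \<open>H\<close>. Hence the SMG residual equals \<open>y' - J grad H_red\<close>
  (\<open>smg_residual_symplectic\<close>), and it vanishes exactly along the solutions of the Hamiltonian
  system of \<open>H_red\<close>.

  Smoothness: write \<open>G q = V + Vbar B(q)\<close>. The orthogonality hypotheses give
  \<open>G\<^sup>T G = 1 + B\<^sup>T Vbar\<^sup>T Vbar B\<close> and \<open>V\<^sup>T G = 1\<close>, so this Gram matrix is invertible, and
  by Cramer's rule the velocity \<open>v(q, p)\<close> is a quotient of polynomials with nonvanishing denominator.

  Symplecticity: the position part of \<open>\<Gamma>\<close> has derivative \<open>G q\<close>, and its momentum part \<open>w\<close>, measured
  from \<open>p_ref\<close>, satisfies the cotangent lift identity \<open>G(q)\<^sup>T w(q, p) = p\<close>. Differentiating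
  \<open>G(q) c \<bullet> w(q, p) = c \<bullet> p\<close> in a direction \<open>h\<close> gives
  \<open>G(q) c \<bullet> Dw[h] = c \<bullet> h\<^sub>p - (Vbar b(c, h\<^sub>q)) \<bullet> w\<close>, where \<open>b\<close> is the symmetric bilinear map
  polarizing the Kronecker square. In \<open>D h \<bullet> J (D k)\<close> the two terms containing \<open>b\<close> cancel by
  symmetry. No derivative of the matrix inverse has to be computed.
\<close>

section \<open>Continuously differentiable functions\<close>

lemma C1_const: "C1 (\<lambda>x. c)"
  unfolding C1_def by (intro exI[of _ "\<lambda>x. 0"]) (auto intro: GDERIV_const)

lemma C1_imp_continuous:
  assumes "C1 f" shows "continuous_on UNIV f"
  using assms unfolding C1_def gderiv_def
  by (meson continuous_at_imp_continuous_on has_derivative_continuous)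

lemma C1_add:
  assumes "C1 f" "C1 g" shows "C1 (\<lambda>x. f x + g x)"
proof -
  obtain f' g' where
    "\<forall>x. GDERIV f x :> f' x" "continuous_on UNIV f'" "\<forall>x. GDERIV g x :> g' x" "continuous_on UNIV g'"
    using assms unfolding C1_def by blast
  then show ?thesis
    unfolding C1_def
    by (intro exI[of _ "\<lambda>x. f' x + g' x"]) (auto intro: GDERIV_add continuous_on_add)
qed

lemma C1_mult:
  assumes "C1 f" "C1 g" shows "C1 (\<lambda>x. f x * g x)"
proof -
  obtain f' g' where
    "\<forall>x. GDERIV f x :> f' x" "continuous_on UNIV f'" "\<forall>x. GDERIV g x :> g' x" "continuous_on UNIV g'"
    using assms unfolding C1_def by blast
  then show ?thesis
    unfolding C1_def using assms[THEN C1_imp_continuous]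
    by (intro exI[of _ "\<lambda>x. f x *\<^sub>R g' x + g x *\<^sub>R f' x"])
       (auto intro!: GDERIV_mult continuous_intros)
qed

lemma C1_inverse:
  assumes "C1 f" "\<And>x. f x \<noteq> 0" shows "C1 (\<lambda>x. inverse (f x))"
proof -
  obtain f' where "\<forall>x. GDERIV f x :> f' x" "continuous_on UNIV f'"
    using assms unfolding C1_def by blast
  moreover have "continuous_on UNIV (\<lambda>x. - (inverse (f x))\<^sup>2 *\<^sub>R f' x)"
    using calculation C1_imp_continuous[OF assms(1)] assms(2) by (intro continuous_intros) auto
  ultimately show ?thesis
    unfolding C1_def
    by (intro exI[of _ "\<lambda>x. - (inverse (f x))\<^sup>2 *\<^sub>R f' x"] conjI allI
        GDERIV_inverse assms(2)) auto
qed

lemma C1_sum: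
  assumes "\<And>i. i \<in> I \<Longrightarrow> C1 (f i)" shows "C1 (\<lambda>x. \<Sum>i\<in>I. f i x)"
  using assms by (induction I rule: infinite_finite_induct) (auto intro: C1_const C1_add)

lemma C1_prod:
  assumes "\<And>i. i \<in> I \<Longrightarrow> C1 (f i)" shows "C1 (\<lambda>x. \<Prod>i\<in>I. f i x)"
  using assms by (induction I rule: infinite_finite_induct) (auto intro: C1_const C1_mult)

lemma C1_nth: "C1 (\<lambda>x :: real ^ 'k::finite. x $ k)"
  unfolding C1_def gderiv_def
  by (intro exI[of _ "\<lambda>x. axis k 1"])
     (auto simp: inner_axis intro: bounded_linear_imp_has_derivative bounded_linear_vec_nth)

lemma C1_det:
  fixes A :: "'a::real_inner \<Rightarrow> real ^ 'k ^ 'k::finite"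
  assumes "\<And>i j. C1 (\<lambda>x. A x $ i $ j)"
  shows "C1 (\<lambda>x. det (A x))"
  unfolding det_def by (intro C1_sum C1_mult C1_const C1_prod assms)

lemma grad_eq:
  assumes "GDERIV f x :> D" shows "grad f x = D"
proof -
  have "D' = D" if "GDERIV f x :> D'" for D'
  proof -
    have "(\<lambda>h. h \<bullet> D') = (\<lambda>h. h \<bullet> D)"
      using that assms unfolding gderiv_def by (rule has_derivative_unique)
    then show ?thesis by (metis vector_eq_ldot)
  qed
  then show ?thesis unfolding grad_def using assms by blast
qed

lemma C1_gderiv:
  assumes "C1 f" shows "GDERIV f x :> grad f x" "continuous_on UNIV (grad f)"
proof -
  obtain g where g: "\<forall>x. GDERIV f x :> g x" "continuous_on UNIV g"
    using assms unfolding C1_def by blast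
  then have "grad f = g" by (auto intro: grad_eq)
  with g show "GDERIV f x :> grad f x" "continuous_on UNIV (grad f)" by auto
qed

section \<open>Jacobian matrices\<close>

lemma has_derivative_vecI:
  fixes f :: "'a::real_normed_vector \<Rightarrow> real ^ 'k::finite"
  assumes "\<And>k. ((\<lambda>x. f x $ k) has_derivative (\<lambda>h. f' h $ k)) F"
  shows "(f has_derivative f') F"
proof -
  have "(\<lambda>x. \<Sum>k\<in>UNIV. f x $ k *\<^sub>R axis k 1 :: real ^ 'k) = f"
       "(\<lambda>h. \<Sum>k\<in>UNIV. f' h $ k *\<^sub>R axis k 1 :: real ^ 'k) = f'"
    by (auto simp: vec_eq_iff axis_def if_distrib cong: if_cong)
  moreover have "((\<lambda>x. \<Sum>k\<in>UNIV. f x $ k *\<^sub>R axis k 1 :: real ^ 'k) has_derivative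
       (\<lambda>h. \<Sum>k\<in>UNIV. f' h $ k *\<^sub>R axis k 1)) F"
    by (intro has_derivative_sum has_derivative_scaleR_left assms)
  ultimately show ?thesis by simp
qed

lemma jacobian_eq:
  fixes f :: "real ^ 'k::finite \<Rightarrow> real ^ 'l::finite"
  assumes "(f has_derivative f') (at x)"
  shows "jacobian f (at x) *v h = f' h"
proof -
  have "f differentiable at x" using assms unfolding differentiable_def by blast
  then have "(f has_derivative (\<lambda>h. jacobian f (at x) *v h)) (at x)"
    by (simp add: jacobian_works)
  from has_derivative_unique[OF this assms] show ?thesis by metis
qed

lemma C1_components_jacobian:
  fixes F :: "real ^ 'k::finite \<Rightarrow> real ^ 'l::finite"
  assumes "\<And>k. C1 (\<lambda>x. F x $ k)"
  shows "(F has_derivative (\<lambda>h. jacobian F (at x) *v h)) (at x)"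
    and "continuous_on UNIV (\<lambda>x. jacobian F (at x))"
proof -
  have D: "(F has_derivative (\<lambda>h. \<chi> k. h \<bullet> grad (\<lambda>x. F x $ k) x)) (at x)" for x
    by (rule has_derivative_vecI)
       (use C1_gderiv(1)[OF assms] in \<open>simp add: gderiv_def\<close>)
  show "(F has_derivative (\<lambda>h. jacobian F (at x) *v h)) (at x)"
    unfolding jacobian_works[symmetric] using D differentiableI by blast
  have "jacobian F (at x) $ k = grad (\<lambda>x. F x $ k) x" for x k
  proof -
    have "jacobian F (at x) $ k $ l = grad (\<lambda>x. F x $ k) x $ l" for l
    proof -
      have "jacobian F (at x) $ k $ l = (jacobian F (at x) *v axis l 1) $ k"
        by (simp add: matrix_vector_mul_component inner_axis)
      then show ?thesis by (simp add: jacobian_eq[OF D] inner_axis' inner_axis)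
    qed
    then show ?thesis by (simp add: vec_eq_iff)
  qed
  then have "(\<lambda>x. jacobian F (at x)) = (\<lambda>x. \<chi> k. grad (\<lambda>x. F x $ k) x)"
    by (simp add: fun_eq_iff vec_eq_iff)
  then show "continuous_on UNIV (\<lambda>x. jacobian F (at x))"
    by (simp only:) (intro continuous_on_vec_lambda C1_gderiv(2) assms)
qed

lemma inner_matrix_transpose:
  fixes A :: "real ^ 'k::finite ^ 'l::finite"
  shows "(A *v x) \<bullet> y = x \<bullet> (transpose A *v y)"
  by (metis dot_lmul_matrix transpose_matrix_vector inner_commute transpose_transpose)

lemma GDERIV_comp_jacobian:
  fixes F :: "real ^ 'k::finite \<Rightarrow> real ^ 'l::finite"
  assumes "C1 H" "\<And>k. C1 (\<lambda>x. F x $ k)"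
  shows "GDERIV (\<lambda>x. H (F x)) x :> transpose (jacobian F (at x)) *v grad H (F x)"
  unfolding gderiv_def inner_matrix_transpose[symmetric]
  by (rule has_derivative_compose[OF C1_components_jacobian(1)[OF assms(2)]
        C1_gderiv(1)[OF assms(1), unfolded gderiv_def]])

lemma C1_comp:
  fixes F :: "real ^ 'k::finite \<Rightarrow> real ^ 'l::finite"
  assumes "C1 H" "\<And>k. C1 (\<lambda>x. F x $ k)"
  shows "C1 (\<lambda>x. H (F x))"
proof -
  have "continuous_on UNIV F"
    by (meson C1_components_jacobian(1)[OF assms(2)] continuous_at_imp_continuous_on has_derivative_continuous)
  then have "continuous_on UNIV (\<lambda>x. grad H (F x))"
    using C1_gderiv(2)[OF assms(1)] continuous_on_compose2 by blast
  then have "continuous_on UNIV (\<lambda>x. transpose (jacobian F (at x)) *v grad H (F x))"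
    unfolding matrix_vector_mult_def transpose_def
    using C1_components_jacobian(2)[OF assms(2)]
    by (auto intro!: continuous_intros)
  then show ?thesis
    unfolding C1_def
    by (intro exI[of _ "\<lambda>x. transpose (jacobian F (at x)) *v grad H (F x)"] conjI allI
        GDERIV_comp_jacobian[OF assms])
qed

section \<open>Linear symplectic algebra\<close>

lemma nth_phase [simp]:
  "phase q p $ Inl i = q $ i" "phase q p $ Inr i = p $ i"
  by (simp_all add: phase_def)

lemma pos_part_nth [simp]: "pos_part y $ i = y $ Inl i"
  and mom_part_nth [simp]: "mom_part y $ i = y $ Inr i"
  by (simp_all add: pos_part_def mom_part_def)

lemma phase_simps [simp]: "pos_part (phase q p) = q" "mom_part (phase q p) = p"
  "phase (pos_part y) (mom_part y) = y"
  by (auto simp: vec_eq_iff phase_def split: sum.split)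

lemma sum_UNIV_Plus:
  fixes f :: "'a::finite + 'b::finite \<Rightarrow> 'c::comm_monoid_add"
  shows "sum f UNIV = (\<Sum>i\<in>UNIV. f (Inl i)) + (\<Sum>i\<in>UNIV. f (Inr i))"
  by (subst UNIV_Plus_UNIV[symmetric], subst sum.Plus) auto

lemma symp_J_mult: "symp_J *v y = phase (mom_part y) (- pos_part y)"
proof -
  have "(symp_J *v y) $ k = phase (mom_part y) (- pos_part y) $ k" for k
    by (cases k) (auto simp: matrix_vector_mult_def symp_J_def sum_UNIV_Plus mat_def
        if_distrib if_distribR sum_negf cong: if_cong)
  then show ?thesis by (simp add: vec_eq_iff)
qed

lemma inner_symp_J: "x \<bullet> (symp_J *v y) = pos_part x \<bullet> mom_part y - mom_part x \<bullet> pos_part y"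
  by (simp add: symp_J_mult inner_vec_def sum_UNIV_Plus sum_negf)

lemma symp_J_squared: "symp_J *v (symp_J *v y) = - y"
proof -
  have "(symp_J *v (symp_J *v y)) $ k = - y $ k" for k
    by (cases k) (auto simp: symp_J_mult)
  then show ?thesis by (simp add: vec_eq_iff)
qed

lemma transpose_symp_J: "transpose symp_J *v y = - (symp_J *v y)"
proof -
  have "transpose symp_J = - (symp_J :: real ^ ('a + 'a) ^ ('a + 'a))"
    by (auto simp: vec_eq_iff transpose_def symp_J_def mat_def split: sum.splits)
  then show ?thesis by (simp add: vec_eq_iff matrix_vector_mult_def sum_negf)
qed

lemma symplectic_inverse_apply:
  "symplectic_inverse A *v x = - (symp_J *v (transpose A *v (symp_J *v x)))"
  by (simp only: symplectic_inverse_def transpose_symp_J matrix_vector_mul_assoc[symmetric])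

text \<open>
  The hypothesis says that \<open>A\<close> preserves the symplectic form \<open>h \<bullet> J k\<close>, that is
  \<open>A\<^sup>T J A = J\<close>.
\<close>

lemma symplectic_inverse_left_inverse:
  fixes A :: "real ^ ('r::finite + 'r) ^ ('n::finite + 'n)"
  assumes "\<And>h k. (A *v h) \<bullet> (symp_J *v (A *v k)) = h \<bullet> (symp_J *v k)"
  shows "symplectic_inverse A *v (A *v k) = k"
proof -
  have "transpose A *v (symp_J *v (A *v k)) = symp_J *v k"
    using assms unfolding inner_matrix_transpose by (metis vector_eq_rdot inner_commute)
  then show ?thesis by (simp add: symplectic_inverse_apply symp_J_squared)
qed

section \<open>The Kronecker square and its derivative\<close>

text \<open>
  The symmetric bilinear map with \<open>kron_polar x x = 2 * kron x\<close>. Defining it by polarization avoids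
  lifting a second function to unordered pairs, and makes its symmetry evident.
\<close>

definition kron_polar :: "real ^ 'r::finite \<Rightarrow> real ^ 'r \<Rightarrow> real ^ 'r uprod" where
  "kron_polar x h = kron (x + h) - kron x - kron h"

lemma kron_polar_nth_Upair [simp]:
  "kron_polar x h $ Upair i j = x $ i * h $ j + h $ i * x $ j"
  by (simp add: kron_polar_def algebra_simps)

lemma kron_polar_commute: "kron_polar x h = kron_polar h x"
  by (simp add: kron_polar_def add.commute)

lemma kron_has_derivative: "(kron has_derivative kron_polar x) (at x)"
proof (rule has_derivative_vecI)
  fix u :: "'a uprod"
  obtain i j where u: "u = Upair i j" by (cases u)
  show "((\<lambda>x. kron x $ u) has_derivative (\<lambda>h. kron_polar x h $ u)) (at x)"
    unfolding u kron_nth_Upair kron_polar_nth_Upair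
    by (intro has_derivative_mult bounded_linear_imp_has_derivative bounded_linear_vec_nth)
qed

lemma kron_deriv_mult: "kron_deriv x *v h = kron_polar x h"
  unfolding kron_deriv_def by (rule jacobian_eq[OF kron_has_derivative])

lemma kron_deriv_nth: "kron_deriv x $ u $ j = kron_polar x (axis j 1) $ u"
  by (simp add: matrix_vector_mul_component inner_axis flip: kron_deriv_mult)

section \<open>The tangent matrix of the quadratic manifold\<close>

text \<open>
  The Jacobian, at \<open>q\<close>, of the position map taking \<open>q\<close> to
  \<open>q_ref + V *v q + Vbar *v kron q\<close>.
\<close>

definition tangent_matrix ::
    "real ^ 'r::finite ^ 'n::finite \<Rightarrow> real ^ 'r uprod ^ 'n \<Rightarrow> real ^ 'r \<Rightarrow> real ^ 'r ^ 'n" where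
  "tangent_matrix V Vbar q = V + Vbar ** kron_deriv q"

lemma tangent_matrix_mult:
  "tangent_matrix V Vbar q *v h = V *v h + Vbar *v kron_polar q h"
  by (simp add: tangent_matrix_def matrix_vector_mult_add_rdistrib kron_deriv_mult
      flip: matrix_vector_mul_assoc)

lemma transpose_add: "transpose (A + B) = transpose A + transpose B"
  by (simp add: transpose_def vec_eq_iff)

lemma matrix_add_rdistrib:
  fixes A B :: "'a::semiring_1 ^ 'm ^ 'n"
  shows "(A + B) ** C = A ** C + B ** C"
  by (simp add: matrix_matrix_mult_def vec_eq_iff sum.distrib distrib_right)

lemma tangent_matrix_gram:
  assumes "transpose V ** V = mat 1" "transpose V ** Vbar = 0"
  shows "transpose (tangent_matrix V Vbar q) ** tangent_matrix V Vbar q =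
    mat 1 + transpose (kron_deriv q) ** transpose Vbar ** Vbar ** kron_deriv q"
proof -
  let ?B = "kron_deriv q"
  have "transpose Vbar ** V = 0"
    using arg_cong[OF assms(2), of transpose]
    by (simp add: matrix_transpose_mul) (simp add: transpose_def vec_eq_iff)
  then have "transpose ?B ** transpose Vbar ** V = 0"
    by (simp flip: matrix_mul_assoc)
  moreover have "transpose V ** (Vbar ** ?B) = 0"
    by (simp add: matrix_mul_assoc assms(2))
  ultimately show ?thesis
    by (simp add: tangent_matrix_def transpose_add matrix_transpose_mul matrix_add_ldistrib
        matrix_add_rdistrib assms(1) matrix_mul_assoc)
qed

text \<open>
  The tangent matrix has full column rank because \<open>transpose V\<close> is a left inverse of it.
\<close>

lemma tangent_matrix_gram_invertible:
  assumes "transpose V ** V = mat 1" "transpose V ** Vbar = 0"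
  shows "invertible (transpose (tangent_matrix V Vbar q) ** tangent_matrix V Vbar q)"
proof -
  let ?G = "tangent_matrix V Vbar q"
  have left: "transpose V ** ?G = mat 1"
    by (simp add: tangent_matrix_def matrix_add_ldistrib matrix_mul_assoc assms)
  have "x = 0" if "(transpose ?G ** ?G) *v x = 0" for x
  proof -
    have "(?G *v x) \<bullet> (?G *v x) = x \<bullet> ((transpose ?G ** ?G) *v x)"
      by (simp only: inner_matrix_transpose matrix_vector_mul_assoc)
    then have "?G *v x = 0" using that by simp
    then show "x = 0"
      by (metis left matrix_vector_mul_assoc matrix_vector_mul_lid matrix_vector_mult_0_right)
  qed
  then show ?thesis
    by (simp only: invertible_left_inverse matrix_left_invertible_ker) blast
qed

lemma qmcl_velocity_solves:
  assumes "transpose V ** V = mat 1" "transpose V ** Vbar = 0"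
  shows "transpose (tangent_matrix V Vbar q) ** tangent_matrix V Vbar q *v qmcl_velocity Vbar q p = p"
proof -
  have "A ** matrix_inv A = mat 1" if "invertible A" for A :: "real ^ 'a ^ 'a"
    using that unfolding invertible_def matrix_inv_def by (rule someI2_ex) blast
  then show ?thesis
    unfolding qmcl_velocity_def
    by (simp only: tangent_matrix_gram[OF assms, symmetric] matrix_vector_mul_assoc
      tangent_matrix_gram_invertible[OF assms] matrix_vector_mul_lid)
qed

section \<open>Smoothness of the QMCL mapping\<close>

lemma C1_kron_deriv: "C1 (\<lambda>y. kron_deriv (pos_part y) $ u $ j)"
proof (cases u)
  case (Upair a b)
  then show ?thesis
    by (simp add: kron_deriv_nth) (intro C1_add C1_mult C1_nth C1_const)
qed

lemma C1_tangent_matrix: "C1 (\<lambda>y. tangent_matrix V Vbar (pos_part y) $ i $ j)"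
  unfolding tangent_matrix_def matrix_matrix_mult_def
  by (simp, intro C1_add C1_sum C1_mult C1_const C1_kron_deriv)

text \<open>Cramer's rule expresses the components of the velocity by determinants.\<close>

lemma C1_qmcl_velocity:
  fixes V :: "real ^ 'r::finite ^ 'n::finite" and Vbar :: "real ^ 'r uprod ^ 'n"
  assumes "transpose V ** V = mat 1" "transpose V ** Vbar = 0"
  shows "C1 (\<lambda>y. qmcl_velocity Vbar (pos_part y) (mom_part y) $ k)"
proof -
  define M where
    "M = (\<lambda>y. transpose (tangent_matrix V Vbar (pos_part y)) ** tangent_matrix V Vbar (pos_part y))"
  have nz: "det (M y) \<noteq> 0" for y
    using tangent_matrix_gram_invertible[OF assms] unfolding M_def invertible_det_nz .
  have C1_M: "C1 (\<lambda>y. M y $ i $ j)" for i j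
    unfolding M_def matrix_matrix_mult_def transpose_def
    by (simp, intro C1_sum C1_mult C1_tangent_matrix)
  have "qmcl_velocity Vbar (pos_part y) (mom_part y) $ k =
      det (\<chi> i j. if j = k then mom_part y $ i else M y $ i $ j) * inverse (det (M y))" for y
  proof -
    have "M y *v qmcl_velocity Vbar (pos_part y) (mom_part y) = mom_part y"
      unfolding M_def by (rule qmcl_velocity_solves[OF assms])
    then show ?thesis
      unfolding cramer[OF nz] by (simp add: divide_inverse)
  qed
  moreover have "C1 (\<lambda>y. det (\<chi> i j. if j = k then mom_part y $ i else M y $ i $ j))"
  proof (rule C1_det)
    fix i j
    show "C1 (\<lambda>y. (\<chi> i j. if j = k then mom_part y $ i else M y $ i $ j) $ i $ j)"
      by (cases "j = k") (simp_all add: C1_nth C1_M)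
  qed
  moreover have "C1 (\<lambda>y. inverse (det (M y)))"
    by (intro C1_inverse C1_det C1_M nz)
  ultimately show ?thesis by (simp add: C1_mult)
qed

lemma C1_qmcl:
  fixes V :: "real ^ 'r::finite ^ 'n::finite"
  assumes "transpose V ** V = mat 1" "transpose V ** Vbar = 0"
  shows "C1 (\<lambda>y. qmcl q_ref p_ref V Vbar y $ k)"
proof (cases k)
  case (Inl i)
  have "C1 (\<lambda>y. kron (pos_part y) $ u)" for u :: "'r uprod"
    by (cases u) (simp add: C1_mult C1_nth)
  with Inl show ?thesis
    unfolding qmcl_def matrix_vector_mult_def
    by (simp, intro C1_add C1_sum C1_mult C1_const C1_nth)
next
  case (Inr i)
  show ?thesis
    unfolding Inr qmcl_def tangent_matrix_def[symmetric] matrix_vector_mult_def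
    by (simp, intro C1_add C1_sum C1_mult C1_const C1_tangent_matrix C1_qmcl_velocity[OF assms])
qed

section \<open>Symplecticity of the QMCL mapping\<close>

lemma bounded_linear_pos_part: "bounded_linear pos_part"
  and bounded_linear_mom_part: "bounded_linear mom_part"
  by (auto intro!: linear_conv_bounded_linear[THEN iffD1] linearI simp: vec_eq_iff)

lemma qmcl_jacobian_symplectic:
  fixes V :: "real ^ 'r::finite ^ 'n::finite" and q_ref p_ref :: "real ^ 'n"
  assumes "transpose V ** V = mat 1" "transpose V ** Vbar = 0"
  defines "D \<equiv> \<lambda>y. jacobian (qmcl q_ref p_ref V Vbar) (at y)"
  shows "(D y *v h) \<bullet> (symp_J *v (D y *v k)) = h \<bullet> (symp_J *v k)"
proof -
  let ?G = "\<lambda>y. tangent_matrix V Vbar (pos_part y)"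
  let ?w = "\<lambda>y. mom_part (qmcl q_ref p_ref V Vbar y) - p_ref"
  have D: "(qmcl q_ref p_ref V Vbar has_derivative (\<lambda>h. D y *v h)) (at y)"
    unfolding D_def by (rule C1_components_jacobian(1)[OF C1_qmcl[OF assms(1,2)]])
  note mult = bounded_linear.has_derivative[OF matrix_vector_mul_bounded_linear]
  note pos = bounded_linear.has_derivative[OF bounded_linear_pos_part]
  note mom = bounded_linear.has_derivative[OF bounded_linear_mom_part]
  have pos_D: "pos_part (D y *v h) = ?G y *v pos_part h" for h
  proof -
    have "((\<lambda>y. q_ref + V *v pos_part y + Vbar *v kron (pos_part y)) has_derivative
       (\<lambda>h. V *v pos_part h + Vbar *v kron_polar (pos_part y) (pos_part h))) (at y)"
      using has_derivative_add[OF has_derivative_add[OF has_derivative_const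
          mult[OF pos[OF has_derivative_ident]]]
          mult[OF has_derivative_compose[OF pos[OF has_derivative_ident] kron_has_derivative]]]
      by simp
    moreover have "(\<lambda>y. pos_part (qmcl q_ref p_ref V Vbar y)) =
        (\<lambda>y. q_ref + V *v pos_part y + Vbar *v kron (pos_part y))"
      by (simp add: qmcl_def)
    ultimately show ?thesis
      using fun_cong[OF has_derivative_unique[OF pos[OF D]], of _ h]
      by (simp add: tangent_matrix_mult)
  qed
  \<comment> \<open>Pairing with a fixed vector \<open>c\<close> makes the cotangent lift identity scalar; since
    \<open>kron_polar c (pos_part y)\<close> is linear in \<open>y\<close>, the product rule then suffices.\<close>
  have w_D: "(?G y *v c) \<bullet> mom_part (D y *v h) =
      c \<bullet> mom_part h - (Vbar *v kron_polar c (pos_part h)) \<bullet> ?w y" for c h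
  proof -
    have eq: "(V *v c + Vbar *v kron_polar c (pos_part y)) \<bullet> ?w y = c \<bullet> mom_part y" for y
    proof -
      have "?w y = ?G y *v qmcl_velocity Vbar (pos_part y) (mom_part y)"
        by (simp add: qmcl_def tangent_matrix_def)
      then have "(?G y *v c) \<bullet> ?w y = c \<bullet> mom_part y"
        by (simp only: inner_matrix_transpose matrix_vector_mul_assoc qmcl_velocity_solves[OF assms(1,2)])
      then show ?thesis by (simp only: tangent_matrix_mult kron_polar_commute[of c])
    qed
    have lin: "bounded_linear (kron_polar c)"
      using kron_has_derivative by (rule has_derivative_bounded_linear)
    have "((\<lambda>y. (V *v c + Vbar *v kron_polar c (pos_part y)) \<bullet> ?w y) has_derivative
        (\<lambda>h. (V *v c + Vbar *v kron_polar c (pos_part y)) \<bullet> mom_part (D y *v h)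
              + (Vbar *v kron_polar c (pos_part h)) \<bullet> ?w y)) (at y)"
      using has_derivative_inner[OF has_derivative_add[OF has_derivative_const
          mult[OF bounded_linear.has_derivative[OF lin pos[OF has_derivative_ident]]]]
          has_derivative_diff[OF mom[OF D] has_derivative_const]]
      by simp
    moreover have "((\<lambda>y. c \<bullet> mom_part y) has_derivative (\<lambda>h. c \<bullet> mom_part h)) (at y)"
      by (intro has_derivative_inner_right mom has_derivative_ident)
    ultimately have "(V *v c + Vbar *v kron_polar c (pos_part y)) \<bullet> mom_part (D y *v h)
        + (Vbar *v kron_polar c (pos_part h)) \<bullet> ?w y = c \<bullet> mom_part h"
      unfolding eq by (rule has_derivative_unique[THEN fun_cong])
    then show ?thesis
      by (simp add: tangent_matrix_mult kron_polar_commute[of "pos_part y"])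
  qed
  show ?thesis
    unfolding inner_symp_J pos_D inner_commute[of "mom_part (D y *v h)"] w_D
    by (simp add: kron_polar_commute[of "pos_part k"] inner_commute)
qed

section \<open>Symplectic manifold Galerkin projection\<close>

text \<open>For every candidate velocity \<open>d\<close>, the projected residual is the residual of the
  Hamiltonian system of \<open>H \<circ> \<Gamma>\<close>.\<close>

lemma smg_residual_symplectic:
  fixes \<Gamma> :: "real ^ ('r::finite + 'r) \<Rightarrow> real ^ ('n::finite + 'n)"
  assumes "C1 H" "\<And>k. C1 (\<lambda>x. \<Gamma> x $ k)"
    and symp: "\<And>h k. (jacobian \<Gamma> (at x) *v h) \<bullet> (symp_J *v (jacobian \<Gamma> (at x) *v k)) = h \<bullet> (symp_J *v k)"
  shows "symplectic_inverse (jacobian \<Gamma> (at x)) *v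
           (jacobian \<Gamma> (at x) *v d - symp_J *v grad H (\<Gamma> x))
         = d - symp_J *v grad (\<lambda>x. H (\<Gamma> x)) x"
proof -
  have neg: "A *v (- v) = - (A *v v)" for A :: "real ^ 'a::finite ^ 'b::finite" and v
    by (simp add: matrix_vector_mult_def vec_eq_iff sum_negf)
  have "symplectic_inverse (jacobian \<Gamma> (at x)) *v (symp_J *v grad H (\<Gamma> x))
      = symp_J *v grad (\<lambda>x. H (\<Gamma> x)) x"
    unfolding grad_eq[OF GDERIV_comp_jacobian[OF assms(1,2)]]
    by (simp only: symplectic_inverse_apply symp_J_squared neg minus_minus)
  then show ?thesis
    by (simp only: matrix_vector_mult_diff_distrib symplectic_inverse_left_inverse[OF symp])
qed

lemma smg_solution_iff_hamiltonian_solution: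
  fixes \<Gamma> :: "real ^ ('r::finite + 'r) \<Rightarrow> real ^ ('n::finite + 'n)"
  assumes "C1 H" "\<And>k. C1 (\<lambda>x. \<Gamma> x $ k)"
    and symp: "\<And>x h k. (jacobian \<Gamma> (at x) *v h) \<bullet> (symp_J *v (jacobian \<Gamma> (at x) *v k)) = h \<bullet> (symp_J *v k)"
    and T: "is_interval T" "interior T \<noteq> {}"
  shows "smg_solution H \<Gamma> T y \<longleftrightarrow> hamiltonian_solution (\<lambda>x. H (\<Gamma> x)) T y"
proof -
  have eq: "symplectic_inverse (jacobian \<Gamma> (at (y t)))
          *v (vector_derivative (\<lambda>s. \<Gamma> (y s)) (at t within T) - symp_J *v grad H (\<Gamma> (y t)))
        = d - symp_J *v grad (\<lambda>x. H (\<Gamma> x)) (y t)"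
    if t: "t \<in> T" and d: "(y has_vector_derivative d) (at t within T)" for t d
  proof -
    \<comment> \<open>\<open>T\<close> is a nondegenerate interval, so derivatives within \<open>T\<close> are unique.\<close>
    have "T \<noteq> {x}" for x using T(2) by auto
    then have "at t within T \<noteq> bot"
      using connected_imp_perfect[OF is_interval_connected[OF T(1)] t]
      by (simp add: trivial_limit_within)
    moreover have "((\<lambda>s. \<Gamma> (y s)) has_vector_derivative jacobian \<Gamma> (at (y t)) *v d) (at t within T)"
      using has_derivative_compose[OF d[unfolded has_vector_derivative_def]
          C1_components_jacobian(1)[OF assms(2)]]
      by (simp add: has_vector_derivative_def matrix_vector_mult_scaleR)
    ultimately have "vector_derivative (\<lambda>s. \<Gamma> (y s)) (at t within T) = jacobian \<Gamma> (at (y t)) *v d"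
      by (rule vector_derivative_within)
    then show ?thesis by (simp only: smg_residual_symplectic[OF assms(1,2) symp])
  qed
  show ?thesis
    unfolding smg_solution_def hamiltonian_solution_def
  proof (rule ball_cong[OF refl], rule iffI)
    fix t
    assume t: "t \<in> T"
    assume *: "y differentiable at t within T \<and>
      symplectic_inverse (jacobian \<Gamma> (at (y t)))
          *v (vector_derivative (\<lambda>s. \<Gamma> (y s)) (at t within T) - symp_J *v grad H (\<Gamma> (y t))) = 0"
    then obtain d where d: "(y has_vector_derivative d) (at t within T)"
      using vector_derivative_works by blast
    with * eq[OF t d] show "(y has_vector_derivative symp_J *v grad (\<lambda>x. H (\<Gamma> x)) (y t)) (at t within T)"
      by simp
  next
    fix t
    assume t: "t \<in> T"
    assume d: "(y has_vector_derivative symp_J *v grad (\<lambda>x. H (\<Gamma> x)) (y t)) (at t within T)"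
    with eq[OF t d] show "y differentiable at t within T \<and>
      symplectic_inverse (jacobian \<Gamma> (at (y t)))
          *v (vector_derivative (\<lambda>s. \<Gamma> (y s)) (at t within T) - symp_J *v grad H (\<Gamma> (y t))) = 0"
      using differentiableI_vector by auto
  qed
qed

section \<open>The reduced Hamiltonian system\<close>

theorem proposition1:
  fixes H :: "real ^ ('n::finite + 'n) \<Rightarrow> real"
    and q_ref p_ref :: "real ^ 'n"
    and V :: "real ^ 'r::finite ^ 'n"
    and Vbar :: "real ^ 'r uprod ^ 'n"
  assumes "CARD('r) \<le> CARD('n)"
    and "C1 H"
    and "transpose V ** V = mat 1"
    and "transpose V ** Vbar = 0"
  shows "\<exists>H_red :: real ^ ('r + 'r) \<Rightarrow> real. C1 H_red \<and>
           (\<forall>T y. is_interval T \<and> interior T \<noteq> {} \<longrightarrow>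
              (smg_solution H (qmcl q_ref p_ref V Vbar) T y \<longleftrightarrow> hamiltonian_solution H_red T y))"
proof (intro exI conjI allI impI)
  let ?H_red = "\<lambda>y. H (qmcl q_ref p_ref V Vbar y)"
  show "C1 ?H_red"
    by (rule C1_comp[OF assms(2) C1_qmcl[OF assms(3,4)]])
  fix T :: "real set" and y
  assume "is_interval T \<and> interior T \<noteq> {}"
  then show "smg_solution H (qmcl q_ref p_ref V Vbar) T y \<longleftrightarrow> hamiltonian_solution ?H_red T y"
    by (intro smg_solution_iff_hamiltonian_solution assms(2) C1_qmcl[OF assms(3,4)]
        qmcl_jacobian_symplectic[OF assms(3,4)]) auto
qed

end
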